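(* A temporal relation $R \subseteq \mathbb{Q}^k$ is preserved by $\mathrm{mx}$ if and only if it is definable by a formula $\phi(v_1, \ldots, v_k)$ that is the conjunction of min-affine formulas, each of which is over a subset of $\{ v_1, \ldots, v_k \}$.
   Context: A temporal relation is a relation on $\mathbb{Q}$ first-order definable over $(\mathbb{Q};<)$; a function preserves a relation if applying it componentwise to tuples of the relation yields a tuple of the relation. The binary operation $\mathrm{mx}$ on $\mathbb{Q}$ is defined by $\mathrm{mx}(x,y)=\alpha(\min(x,y))$ if $x\neq y$ and $\mathrm{mx}(x,y)=\beta(x)$ if $x=y$, where $\alpha,\beta$ are unary operations preserving $<$ such that $\alpha(x)<\beta(x)<\alpha(x+\varepsilon)$ for all $x\in\mathbb{Q}$ and all rational $\varepsilon>0$. A boolean relation $S\subseteq\{0,1\}^n$ is near-affine if $S\cup\{(1,\ldots,1)\}$ is preserved by $a(x,y)=x\oplus y\oplus 1$. A formula $\phi$ is min-affine if there is a near-affine relation $T\subseteq\{0,1\}^n$ such that $\phi$ is of the form $\bigvee_{t\in T}\big((\bigwedge_{i,j:\,t_i=t_j=0} x_i=x_j)\wedge(\bigwedge_{i,j:\,t_i=0,t_j=1} x_i<x_j)\big)$ over variables $x_1,\ldots,x_n$, interpreted over the ordered rationals. The empty conjunction of min-affine formulas (true) and min-affine formulas with $T=\emptyset$ (false) are permitted. *)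

theory Defs
  imports Complex_Main "HOL-Library.Z2"
begin

text \<open>First-order logic over the signature \<open>{<}\<close> with equality, with named variables.\<close>

datatype fm =
    Less nat nat
  | Eq nat nat
  | Neg fm
  | Conj "fm list"
  | Disj "fm list"
  | Exi nat fm

fun fv :: "fm \<Rightarrow> nat set" where
  "fv (Less i j) = {i, j}"
| "fv (Eq i j) = {i, j}"
| "fv (Neg \<phi>) = fv \<phi>"
| "fv (Conj \<phi>s) = (\<Union>\<phi>\<in>set \<phi>s. fv \<phi>)"
| "fv (Disj \<phi>s) = (\<Union>\<phi>\<in>set \<phi>s. fv \<phi>)"
| "fv (Exi i \<phi>) = fv \<phi> - {i}"

fun sat :: "(nat \<Rightarrow> rat) \<Rightarrow> fm \<Rightarrow> bool" where
  "sat e (Less i j) \<longleftrightarrow> e i < e j"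
| "sat e (Eq i j) \<longleftrightarrow> e i = e j"
| "sat e (Neg \<phi>) \<longleftrightarrow> \<not> sat e \<phi>"
| "sat e (Conj \<phi>s) \<longleftrightarrow> (\<forall>\<phi>\<in>set \<phi>s. sat e \<phi>)"
| "sat e (Disj \<phi>s) \<longleftrightarrow> (\<exists>\<phi>\<in>set \<phi>s. sat e \<phi>)"
| "sat e (Exi i \<phi>) \<longleftrightarrow> (\<exists>q. sat (e(i := q)) \<phi>)"

text \<open>Tuples of length \<open>k\<close> are lists; the variables \<open>v\<^sub>1, \<dots>, v\<^sub>k\<close> are numbered \<open>0, \<dots>, k - 1\<close>.\<close>

definition fo_defines :: "nat \<Rightarrow> fm \<Rightarrow> rat list set \<Rightarrow> bool" where
  "fo_defines k \<phi> R \<longleftrightarrow> fv \<phi> \<subseteq> {..<k} \<and> R = {v. length v = k \<and> sat (\<lambda>i. v ! i) \<phi>}"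

definition temporal_relation :: "nat \<Rightarrow> rat list set \<Rightarrow> bool" where
  "temporal_relation k R \<longleftrightarrow> (\<exists>\<phi>. fo_defines k \<phi> R)"

definition preserves :: "('a \<Rightarrow> 'a \<Rightarrow> 'a) \<Rightarrow> 'a list set \<Rightarrow> bool" where
  "preserves f R \<longleftrightarrow> (\<forall>x\<in>R. \<forall>y\<in>R. map2 f x y \<in> R)"

definition mx :: "(rat \<Rightarrow> rat) \<Rightarrow> (rat \<Rightarrow> rat) \<Rightarrow> rat \<Rightarrow> rat \<Rightarrow> rat" where
  "mx \<alpha> \<beta> x y = (if x \<noteq> y then \<alpha> (min x y) else \<beta> x)"

text \<open>On type \<open>bit\<close>, addition is exclusive or.\<close>

definition near_affine :: "nat \<Rightarrow> bit list set \<Rightarrow> bool" where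
  "near_affine n S \<longleftrightarrow> S \<subseteq> {t. length t = n} \<and>
     preserves (\<lambda>x y. x + y + 1) (S \<union> {replicate n 1})"

definition min_affine_disjunct :: "nat list \<Rightarrow> bit list \<Rightarrow> fm" where
  "min_affine_disjunct xs t = Conj
     [Conj [Eq (xs ! i) (xs ! j). i \<leftarrow> [0..<length xs], j \<leftarrow> [0..<length xs], t ! i = 0 \<and> t ! j = 0],
      Conj [Less (xs ! i) (xs ! j). i \<leftarrow> [0..<length xs], j \<leftarrow> [0..<length xs], t ! i = 0 \<and> t ! j = 1]]"

text \<open>\<open>min_affine V \<phi>\<close>: \<open>\<phi>\<close> is a min-affine formula whose variables \<open>x\<^sub>1, \<dots>, x\<^sub>n\<close> are pairwise
  distinct and form the set \<open>V\<close>. The list \<open>ts\<close> enumerates the near-affine relation \<open>T\<close>.\<close>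

definition min_affine :: "nat set \<Rightarrow> fm \<Rightarrow> bool" where
  "min_affine V \<phi> \<longleftrightarrow> (\<exists>xs ts. distinct xs \<and> set xs = V \<and> near_affine (length xs) (set ts) \<and>
     \<phi> = Disj (map (min_affine_disjunct xs) ts))"

end

theory Submission
  imports Defs
begin

text \<open>
  Membership of a tuple in a temporal relation \<open>R\<close> depends only on the order type of the tuple.
  For a set \<open>V\<close> of coordinates, a min-affine formula over \<open>V\<close> constrains only the set of
  coordinates at which the minimum over \<open>V\<close> is attained, recorded by its indicator vector
  (\<open>0\<close> at a minimum, \<open>1\<close> elsewhere). If two tuples have the same minimum over \<open>V\<close>, then \<open>mx\<close> acts
  on distinct indicators as \<open>x + y + 1\<close>; if the minima differ, it keeps the indicator of the smaller one.
  This makes min-affine formulas invariant under \<open>mx\<close>, and conversely it makes the set of indicators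
  over \<open>V\<close> of the tuples of an \<open>mx\<close>-closed \<open>R\<close> near-affine.

  These indicator sets, over all \<open>V\<close>, determine \<open>R\<close>. Suppose every indicator of \<open>v\<close> is the
  indicator of some tuple of \<open>R\<close>. By induction on \<open>V\<close> there is a tuple of \<open>R\<close> ordered like \<open>v\<close>
  on \<open>V\<close>: apply \<open>mx\<close> to a tuple \<open>r\<close> ordered like \<open>v\<close> on the non-minimal coordinates of \<open>V\<close> and a
  tuple \<open>s\<close> with the right indicator over \<open>V\<close>, stretched so that all of \<open>r\<close> lies between the minimum
  of \<open>s\<close> over \<open>V\<close> and the other values of \<open>s\<close> on \<open>V\<close>.
\<close>

section \<open>Order types and first-order definability over a dense order\<close>

lemma dense_between_finite:
  fixes L U :: "'a::{dense_linorder, no_top, no_bot} set"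
  assumes "finite L" "finite U" "\<And>l u. l \<in> L \<Longrightarrow> u \<in> U \<Longrightarrow> l < u"
  shows "\<exists>q. (\<forall>l\<in>L. l < q) \<and> (\<forall>u\<in>U. q < u)"
proof (cases "L = {}")
  case True
  then show ?thesis
  proof (cases "U = {}")
    case False
    obtain q where "q < Min U" using lt_ex by blast
    then show ?thesis using True False assms(2) by auto
  qed (use True in auto)
next
  case L: False
  show ?thesis
  proof (cases "U = {}")
    case True
    obtain q where "Max L < q" using gt_ex by blast
    then show ?thesis using True L assms(1) by auto
  next
    case False
    then have "Max L < Min U" using L assms by simp
    then obtain q where "Max L < q" "q < Min U" using dense by blast
    then show ?thesis using L False assms(1,2) by auto
  qed
qed

lemma finite_fv: "finite (fv \<phi>)"
  by (induction \<phi>) auto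

text \<open>Only \<open><\<close> is compared: in a linear order, agreement on equality
  follows.\<close>

definition same_order_on :: "'a set \<Rightarrow> ('a \<Rightarrow> 'b::linorder) \<Rightarrow> ('a \<Rightarrow> 'b) \<Rightarrow> bool" where
  "same_order_on A e e' \<longleftrightarrow> (\<forall>i\<in>A. \<forall>j\<in>A. e i < e j \<longleftrightarrow> e' i < e' j)"

lemma same_order_on_sym: "same_order_on A e e' \<Longrightarrow> same_order_on A e' e"
  by (simp add: same_order_on_def)

lemma same_order_on_subset: "same_order_on B e e' \<Longrightarrow> A \<subseteq> B \<Longrightarrow> same_order_on A e e'"
  by (auto simp: same_order_on_def)

lemma same_order_on_eq: "same_order_on A e e' \<Longrightarrow> i \<in> A \<Longrightarrow> j \<in> A \<Longrightarrow> e i = e j \<longleftrightarrow> e' i = e' j"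
  using linorder_neq_iff[of "e i" "e j"] linorder_neq_iff[of "e' i" "e' j"]
  unfolding same_order_on_def by blast

text \<open>Back-and-forth step: a value \<open>q\<close> already taken by \<open>e\<close> is
  matched by the corresponding value of \<open>e'\<close>; otherwise \<open>q\<close> lies in a cut
  of finitely many values, and density without endpoints fills the corresponding cut for
  \<open>e'\<close>.\<close>

lemma same_order_on_extend:
  fixes e e' :: "'a \<Rightarrow> 'b::{dense_linorder, no_top, no_bot}"
  assumes fin: "finite A" and so: "same_order_on (A - {i}) e e'"
  shows "\<exists>q'. same_order_on A (e(i := q)) (e'(i := q'))"
proof (cases "\<exists>j\<in>A - {i}. e j = q")
  case True
  then obtain j where j: "j \<in> A - {i}" "e j = q" by blast
  have "same_order_on A (e(i := q)) (e'(i := e' j))"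
    using so j unfolding same_order_on_def by auto
  then show ?thesis by blast
next
  case False
  define L where "L = e' ` {j \<in> A - {i}. e j < q}"
  define U where "U = e' ` {j \<in> A - {i}. q < e j}"
  have "\<exists>q'. (\<forall>l\<in>L. l < q') \<and> (\<forall>u\<in>U. q' < u)"
  proof (rule dense_between_finite)
    show "finite L" "finite U" using fin by (auto simp: L_def U_def)
    show "l < u" if "l \<in> L" "u \<in> U" for l u
    proof -
      obtain a where a: "a \<in> A - {i}" "e a < q" "l = e' a" using \<open>l \<in> L\<close> by (auto simp: L_def)
      obtain b where b: "b \<in> A - {i}" "q < e b" "u = e' b" using \<open>u \<in> U\<close> by (auto simp: U_def)
      have "e a < e b" using a b by (meson less_trans)
      then show ?thesis using so a b unfolding same_order_on_def by blast
    qed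
  qed
  then obtain q' where q': "\<forall>l\<in>L. l < q'" "\<forall>u\<in>U. q' < u" by blast
  have below: "e j < q \<longleftrightarrow> e' j < q'" and above: "q < e j \<longleftrightarrow> q' < e' j" if "j \<in> A" "j \<noteq> i" for j
  proof -
    have "e j < q \<or> q < e j" using False that by (metis DiffI empty_iff insert_iff linorder_less_linear)
    moreover have "e j < q \<Longrightarrow> e' j < q'" "q < e j \<Longrightarrow> q' < e' j"
      using q' that by (auto simp: L_def U_def)
    ultimately show "e j < q \<longleftrightarrow> e' j < q'" "q < e j \<longleftrightarrow> q' < e' j"
      by (meson less_asym)+
  qed
  have "same_order_on A (e(i := q)) (e'(i := q'))"
    using so below above unfolding same_order_on_def by auto
  then show ?thesis by blast
qed

text \<open>Induction on the formula; the quantifier case is the back-and-forth extension, applied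
  in both directions.\<close>

lemma sat_same_order: "same_order_on (fv \<phi>) e e' \<Longrightarrow> sat e \<phi> \<longleftrightarrow> sat e' \<phi>"
proof (induction \<phi> arbitrary: e e')
  case (Less i j)
  then show ?case by (simp add: same_order_on_def)
next
  case (Eq i j)
  then show ?case using same_order_on_eq[OF Eq, of i j] by simp
next
  case (Neg \<phi>)
  then show ?case by simp
next
  case (Conj \<phi>s)
  have "sat e \<phi> = sat e' \<phi>" if "\<phi> \<in> set \<phi>s" for \<phi>
    by (rule Conj.IH[OF that], rule same_order_on_subset[OF Conj.prems]) (use that in auto)
  then show ?case by simp
next
  case (Disj \<phi>s)
  have "sat e \<phi> = sat e' \<phi>" if "\<phi> \<in> set \<phi>s" for \<phi>
    by (rule Disj.IH[OF that], rule same_order_on_subset[OF Disj.prems]) (use that in auto)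
  then show ?case by simp
next
  case (Exi i \<phi>)
  have "\<exists>q'. sat (e2(i := q')) \<phi>"
    if so: "same_order_on (fv \<phi> - {i}) e1 e2" and "sat (e1(i := q)) \<phi>" for e1 e2 q
    using same_order_on_extend[OF finite_fv so, of q] Exi.IH that(2) by blast
  then show ?case using Exi.prems same_order_on_sym[OF Exi.prems] by (auto simp del: fun_upd_apply)
qed

lemma temporal_relation_same_order:
  assumes "temporal_relation k R" "x \<in> R" "length y = k" "same_order_on {..<k} ((!) x) ((!) y)"
  shows "y \<in> R"
proof -
  obtain \<phi> where "fv \<phi> \<subseteq> {..<k}" and R: "R = {v. length v = k \<and> sat ((!) v) \<phi>}"
    using assms(1) unfolding temporal_relation_def fo_defines_def by blast
  then have "same_order_on (fv \<phi>) ((!) x) ((!) y)"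
    using assms(4) same_order_on_subset by blast
  then show ?thesis using sat_same_order R assms(2,3) by blast
qed

lemma temporal_relation_length: "temporal_relation k R \<Longrightarrow> x \<in> R \<Longrightarrow> length x = k"
  by (auto simp: temporal_relation_def fo_defines_def)

text \<open>Strictly increasing maps keep the order type. This allows tuples of \<open>R\<close> to
  be shifted and stretched before \<open>mx\<close> is applied.\<close>

lemma temporal_relation_map_strict_mono:
  assumes "temporal_relation k R" "x \<in> R" "strict_mono f"
  shows "map f x \<in> R"
proof (rule temporal_relation_same_order[OF assms(1,2)])
  have len: "length x = k" using temporal_relation_length assms by blast
  then show "length (map f x) = k" by simp
  show "same_order_on {..<k} ((!) x) ((!) (map f x))"
    using len assms(3) by (auto simp: same_order_on_def strict_mono_less)
qed

section \<open>Sets of minima and the meaning of min-affine formulas\<close>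

definition argmin_set :: "'a set \<Rightarrow> ('a \<Rightarrow> 'b::linorder) \<Rightarrow> 'a set" where
  "argmin_set V e = {i \<in> V. \<forall>j\<in>V. e i \<le> e j}"

lemma argmin_set_eqI:
  assumes "i \<in> V" "e i = m" "\<And>j. j \<in> V \<Longrightarrow> m \<le> e j"
  shows "argmin_set V e = {j \<in> V. e j = m}"
  using assms unfolding argmin_set_def by (auto intro: antisym)

lemma argmin_set_cong: "(\<And>i. i \<in> V \<Longrightarrow> e i = e' i) \<Longrightarrow> argmin_set V e = argmin_set V e'"
  by (auto simp: argmin_set_def)

lemma argmin_set_nonempty:
  assumes "finite V" "V \<noteq> {}"
  shows "argmin_set V e \<noteq> {}"
proof -
  have "Min (e ` V) \<in> e ` V" using assms by simp
  then obtain i where "i \<in> V" "e i = Min (e ` V)" by auto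
  then have "i \<in> argmin_set V e" using assms by (auto simp: argmin_set_def)
  then show ?thesis by blast
qed

definition min_indicator :: "nat list \<Rightarrow> (nat \<Rightarrow> rat) \<Rightarrow> bit list" where
  "min_indicator xs e = map (\<lambda>i. if i \<in> argmin_set (set xs) e then 0 else 1) xs"

lemma length_min_indicator [simp]: "length (min_indicator xs e) = length xs"
  by (simp add: min_indicator_def)

lemma min_indicator_eq_iff:
  "min_indicator xs e = min_indicator xs e' \<longleftrightarrow> argmin_set (set xs) e = argmin_set (set xs) e'"
  by (auto simp: min_indicator_def argmin_set_def split: if_splits)

text \<open>The minimum over a nonempty finite set is attained, so some entry is \<open>0\<close>.
  This excludes the vector that near-affinity admits as an exception.\<close>

lemma min_indicator_neq_ones: "xs \<noteq> [] \<Longrightarrow> min_indicator xs e \<noteq> replicate (length xs) 1"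
proof
  assume "xs \<noteq> []" and eq: "min_indicator xs e = replicate (length xs) 1"
  then obtain i where i: "i \<in> argmin_set (set xs) e"
    using argmin_set_nonempty[of "set xs" e] by auto
  then have "i \<in> set xs" by (simp add: argmin_set_def)
  then have "0 \<in> set (min_indicator xs e)" using i by (force simp: min_indicator_def)
  then show False by (simp add: eq)
qed

lemma sat_Conj_comprehension:
  "sat e (Conj [f i j. i \<leftarrow> [0..<m], j \<leftarrow> [0..<n], P i j]) \<longleftrightarrow>
    (\<forall>i<m. \<forall>j<n. P i j \<longrightarrow> sat e (f i j))"
proof -
  have *: "set [f i j. i \<leftarrow> [0..<m], j \<leftarrow> [0..<n], P i j] = {f i j | i j. i < m \<and> j < n \<and> P i j}"
    by (fastforce simp: image_iff)
  show ?thesis by (simp only: sat.simps *) blast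
qed

text \<open>The all-ones vector makes both conjunctions empty, hence true. Any other
  \<open>t\<close> has a zero entry, and comparing all coordinates with that one forces the zeros of
  \<open>t\<close> to be exactly the minima.\<close>

lemma sat_min_affine_disjunct:
  assumes "length t = length xs"
  shows "sat e (min_affine_disjunct xs t) \<longleftrightarrow>
    t = replicate (length xs) 1 \<or> t = min_indicator xs e"
proof -
  let ?n = "length xs"
  have sat: "sat e (min_affine_disjunct xs t) \<longleftrightarrow>
    (\<forall>i<?n. \<forall>j<?n. (t ! i = 0 \<and> t ! j = 0 \<longrightarrow> e (xs ! i) = e (xs ! j)) \<and>
       (t ! i = 0 \<and> t ! j = 1 \<longrightarrow> e (xs ! i) < e (xs ! j)))"
    unfolding min_affine_disjunct_def sat.simps(4)[of e "[_, _]"] list.set ball_simps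
      sat_Conj_comprehension sat.simps(1,2) by blast
  have am: "xs ! i \<in> argmin_set (set xs) e \<longleftrightarrow> (\<forall>j<?n. e (xs ! i) \<le> e (xs ! j))" if "i < ?n" for i
    using that by (auto simp: argmin_set_def all_set_conv_all_nth)
  have ind: "t = min_indicator xs e \<longleftrightarrow>
    (\<forall>i<?n. t ! i = 0 \<longleftrightarrow> (\<forall>j<?n. e (xs ! i) \<le> e (xs ! j)))"
    using assms am by (auto simp: list_eq_iff_nth_eq min_indicator_def)
  have ones: "t = replicate ?n 1 \<longleftrightarrow> (\<forall>i<?n. t ! i = 1)"
    using assms by (auto simp: list_eq_iff_nth_eq)
  have bit: "t ! i = 0 \<or> t ! i = 1" for i by auto
  show ?thesis
  proof
    assume s: "sat e (min_affine_disjunct xs t)"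
    show "t = replicate ?n 1 \<or> t = min_indicator xs e"
    proof (cases "\<forall>i<?n. t ! i = 1")
      case False
      then obtain i where i: "i < ?n" "t ! i = 0" using bit by blast
      have "t ! i' = 0 \<longleftrightarrow> (\<forall>j<?n. e (xs ! i') \<le> e (xs ! j))" if "i' < ?n" for i'
        using s i that bit unfolding sat by (metis leD less_imp_le order_refl)
      then show ?thesis using ind by blast
    qed (use ones in blast)
  next
    assume "t = replicate ?n 1 \<or> t = min_indicator xs e"
    then show "sat e (min_affine_disjunct xs t)"
    proof
      assume "t = replicate ?n 1"
      then show ?thesis unfolding sat ones by auto
    next
      assume "t = min_indicator xs e"
      then show ?thesis unfolding sat ind by (metis antisym bit not_less zero_neq_one)
    qed
  qed
qed

lemma fv_min_affine_disjunct: "fv (min_affine_disjunct xs t) \<subseteq> set xs"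
  unfolding min_affine_disjunct_def by (auto simp: in_set_conv_nth)

text \<open>The all-ones vector is neutral for \<open>x + y + 1\<close>, so only pairs from
  \<open>S\<close> have to be checked.\<close>

lemma near_affine_iff:
  assumes "S \<subseteq> {t. length t = n}"
  shows "near_affine n S \<longleftrightarrow>
    (\<forall>x\<in>S. \<forall>y\<in>S. map2 (\<lambda>x y. x + y + 1) x y \<in> S \<union> {replicate n 1})"
proof -
  have 1: "map2 (\<lambda>x y. x + y + 1) (replicate n 1) y = y" if "length y = n" for y :: "bit list"
    using that by (auto simp: list_eq_iff_nth_eq)
  have 2: "map2 (\<lambda>x y. x + y + 1) x (replicate n 1) = x" if "length x = n" for x :: "bit list"
    using that by (auto simp: list_eq_iff_nth_eq add.assoc)
  show ?thesis
    using assms 1 2 unfolding near_affine_def preserves_def by (auto simp: subset_iff)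
qed

section \<open>The action of \<open>mx\<close> on sets of minima\<close>

locale mx_ops =
  fixes \<alpha> \<beta> :: "rat \<Rightarrow> rat"
  assumes mono_alpha: "strict_mono \<alpha>"
    and alpha_less_beta: "\<alpha> x < \<beta> x"
    and beta_less_alpha: "x < y \<Longrightarrow> \<beta> x < \<alpha> y"
begin

lemma mx_commute: "mx \<alpha> \<beta> x y = mx \<alpha> \<beta> y x"
  by (simp add: mx_def min.commute)

lemma alpha_le_mx: "m \<le> x \<Longrightarrow> m \<le> y \<Longrightarrow> \<alpha> m \<le> mx \<alpha> \<beta> x y"
  using strict_mono_less_eq[OF mono_alpha, of m "min x y"] alpha_less_beta[of x]
  by (auto simp: mx_def)

lemma beta_less_mx: "m < x \<Longrightarrow> m < y \<Longrightarrow> \<beta> m < mx \<alpha> \<beta> x y"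
  using beta_less_alpha[of m "min x y"] alpha_less_beta[of x]
  by (auto simp: mx_def)

text \<open>For arguments bounded below by \<open>m\<close>, the values of \<open>mx\<close> come in
  three levels: \<open>\<alpha> m\<close> if exactly one argument is \<open>m\<close>, then
  \<open>\<beta> m\<close> if both are, then everything else.\<close>

lemma mx_eq_alpha_iff:
  assumes "m \<le> x" "m \<le> y"
  shows "mx \<alpha> \<beta> x y = \<alpha> m \<longleftrightarrow> (x = m) \<noteq> (y = m)"
proof (cases "m < x \<and> m < y")
  case True
  then show ?thesis using beta_less_mx[of m x y] alpha_less_beta[of m] by auto
next
  case False
  then show ?thesis using assms alpha_less_beta[of m] by (auto simp: mx_def min_def)
qed

lemma mx_eq_beta:
  assumes "m \<le> x" "m \<le> y" "(x = m) = (y = m)"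
  shows "\<beta> m \<le> mx \<alpha> \<beta> x y" "mx \<alpha> \<beta> x y = \<beta> m \<longleftrightarrow> x = m"
proof -
  have "mx \<alpha> \<beta> x y = \<beta> m" if "x = m" using that assms by (simp add: mx_def)
  moreover have "\<beta> m < mx \<alpha> \<beta> x y" if "x \<noteq> m" using that assms by (intro beta_less_mx) auto
  ultimately show "\<beta> m \<le> mx \<alpha> \<beta> x y" "mx \<alpha> \<beta> x y = \<beta> m \<longleftrightarrow> x = m" by force+
qed

text \<open>As \<open>e'\<close> lies strictly above the minimum of \<open>e\<close>, the least
  value \<open>\<alpha> (e i)\<close> arises exactly where \<open>e\<close> attains its
  minimum.\<close>

lemma argmin_set_mx_less:
  assumes "i \<in> V" "\<And>j. j \<in> V \<Longrightarrow> e i \<le> e j" "\<And>j. j \<in> V \<Longrightarrow> e i < e' j"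
  shows "argmin_set V (\<lambda>j. mx \<alpha> \<beta> (e j) (e' j)) = argmin_set V e"
proof -
  have *: "mx \<alpha> \<beta> (e j) (e' j) = \<alpha> (e i) \<longleftrightarrow> e j = e i" if "j \<in> V" for j
    using mx_eq_alpha_iff[of "e i" "e j" "e' j"] assms(2,3)[OF that] by auto
  have "argmin_set V (\<lambda>j. mx \<alpha> \<beta> (e j) (e' j)) = {j \<in> V. mx \<alpha> \<beta> (e j) (e' j) = \<alpha> (e i)}"
    by (rule argmin_set_eqI[of i]) (use assms * in \<open>auto intro!: alpha_le_mx intro: less_imp_le\<close>)
  also have "\<dots> = {j \<in> V. e j = e i}" using * by auto
  also have "\<dots> = argmin_set V e" by (rule argmin_set_eqI[symmetric]) (use assms in auto)
  finally show ?thesis .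
qed

text \<open>With common minimum \<open>m\<close>, the value \<open>\<alpha> m\<close> arises on the
  symmetric difference of the two sets of minima. If these coincide it never arises on
  \<open>V\<close>, and \<open>\<beta> m\<close> is the minimum, attained on the same set.\<close>

lemma argmin_set_mx_eq:
  assumes i: "i \<in> V" "\<And>j. j \<in> V \<Longrightarrow> e i \<le> e j"
    and i': "i' \<in> V" "\<And>j. j \<in> V \<Longrightarrow> e' i' \<le> e' j" and "e i = e' i'"
  shows "argmin_set V (\<lambda>j. mx \<alpha> \<beta> (e j) (e' j)) =
    (if argmin_set V e = argmin_set V e' then argmin_set V e
     else {j \<in> V. (j \<in> argmin_set V e) \<noteq> (j \<in> argmin_set V e')})"
proof -
  let ?z = "\<lambda>j. mx \<alpha> \<beta> (e j) (e' j)"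
  define m where "m = e i"
  have le: "m \<le> e j" "m \<le> e' j" if "j \<in> V" for j using assms that by (auto simp: m_def)
  have A: "argmin_set V e = {j \<in> V. e j = m}" "argmin_set V e' = {j \<in> V. e' j = m}"
    using argmin_set_eqI[of i V e m] argmin_set_eqI[of i' V e' m] assms le by (auto simp: m_def)
  show ?thesis
  proof (cases "argmin_set V e = argmin_set V e'")
    case True
    then have eq: "(e j = m) = (e' j = m)" if "j \<in> V" for j using that A by blast
    have "argmin_set V ?z = {j \<in> V. ?z j = \<beta> m}"
    proof (rule argmin_set_eqI[of i])
      show "?z i = \<beta> m" using mx_eq_beta(2) i(1) le eq m_def by blast
      show "\<beta> m \<le> ?z j" if "j \<in> V" for j using mx_eq_beta(1) that le eq by blast
    qed (fact i(1))
    also have "\<dots> = {j \<in> V. e j = m}" using mx_eq_beta(2) le eq by blast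
    finally show ?thesis using True A by simp
  next
    case False
    then obtain j where j: "j \<in> V" "(e j = m) \<noteq> (e' j = m)" using A by blast
    have "argmin_set V ?z = {j \<in> V. ?z j = \<alpha> m}"
      by (rule argmin_set_eqI[of j]) (use j le mx_eq_alpha_iff in \<open>auto intro!: alpha_le_mx\<close>)
    also have "\<dots> = {j \<in> V. (e j = m) \<noteq> (e' j = m)}" using mx_eq_alpha_iff le by blast
    finally show ?thesis using False A by auto
  qed
qed

text \<open>Since \<open>0\<close> marks a minimum and \<open>x + y + 1\<close> is \<open>0\<close>
  exactly when the bits differ, the symmetric difference turns into this operation on
  indicators.\<close>

lemma min_indicator_mx_eq:
  assumes "i \<in> argmin_set (set xs) e" "i' \<in> argmin_set (set xs) e'" "e i = e' i'"
  shows "min_indicator xs (\<lambda>j. mx \<alpha> \<beta> (e j) (e' j)) =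
    (if min_indicator xs e = min_indicator xs e' then min_indicator xs e
     else map2 (\<lambda>x y. x + y + 1) (min_indicator xs e) (min_indicator xs e'))"
proof -
  have *: "argmin_set (set xs) (\<lambda>j. mx \<alpha> \<beta> (e j) (e' j)) =
    (if argmin_set (set xs) e = argmin_set (set xs) e' then argmin_set (set xs) e
     else {j \<in> set xs. (j \<in> argmin_set (set xs) e) \<noteq> (j \<in> argmin_set (set xs) e')})"
    by (rule argmin_set_mx_eq[of i _ _ i']) (use assms in \<open>auto simp: argmin_set_def\<close>)
  show ?thesis
  proof (cases "argmin_set (set xs) e = argmin_set (set xs) e'")
    case True
    then show ?thesis using * min_indicator_eq_iff by simp
  next
    case False
    then have "min_indicator xs e \<noteq> min_indicator xs e'" by (simp add: min_indicator_eq_iff)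
    moreover have "min_indicator xs (\<lambda>j. mx \<alpha> \<beta> (e j) (e' j)) =
      map2 (\<lambda>x y. x + y + 1) (min_indicator xs e) (min_indicator xs e')"
      using * False by (auto simp: list_eq_iff_nth_eq min_indicator_def)
    ultimately show ?thesis by simp
  qed
qed

lemma min_indicator_mx_cases:
  assumes "xs \<noteq> []"
  shows "min_indicator xs (\<lambda>j. mx \<alpha> \<beta> (e j) (e' j)) \<in>
    {min_indicator xs e, min_indicator xs e',
     map2 (\<lambda>x y. x + y + 1) (min_indicator xs e) (min_indicator xs e')}"
proof -
  obtain i i' where i: "i \<in> argmin_set (set xs) e" "i' \<in> argmin_set (set xs) e'"
    using assms argmin_set_nonempty[of "set xs"] by blast
  consider "e i < e' i'" | "e' i' < e i" | "e i = e' i'" by force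
  then show ?thesis
  proof cases
    case 1
    have "argmin_set (set xs) (\<lambda>j. mx \<alpha> \<beta> (e j) (e' j)) = argmin_set (set xs) e"
      by (rule argmin_set_mx_less[of i]) (use i 1 in \<open>auto simp: argmin_set_def intro: less_le_trans\<close>)
    then show ?thesis by (simp add: min_indicator_eq_iff)
  next
    case 2
    have "argmin_set (set xs) (\<lambda>j. mx \<alpha> \<beta> (e' j) (e j)) = argmin_set (set xs) e'"
      by (rule argmin_set_mx_less[of i']) (use i 2 in \<open>auto simp: argmin_set_def intro: less_le_trans\<close>)
    then show ?thesis by (simp add: min_indicator_eq_iff mx_commute[of "e _"])
  next
    case 3
    then show ?thesis using min_indicator_mx_eq[OF i] by simp
  qed
qed

text \<open>If \<open>ts\<close> contains the all-ones vector, the formula is always true. Otherwise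
  near-affinity puts the combined indicator in \<open>ts\<close> or makes it all ones, and no
  indicator over a nonempty list is all ones.\<close>

lemma sat_min_affine_mx:
  assumes "min_affine V \<psi>" "sat e \<psi>" "sat e' \<psi>"
  shows "sat (\<lambda>j. mx \<alpha> \<beta> (e j) (e' j)) \<psi>"
proof -
  obtain xs ts where na: "near_affine (length xs) (set ts)"
    and \<psi>: "\<psi> = Disj (map (min_affine_disjunct xs) ts)"
    using assms(1) unfolding min_affine_def by blast
  let ?one = "replicate (length xs) (1 :: bit)"
  have len: "set ts \<subseteq> {t. length t = length xs}" using na by (simp add: near_affine_def)
  have sat: "sat d \<psi> \<longleftrightarrow> ?one \<in> set ts \<or> min_indicator xs d \<in> set ts" for d
    using len sat_min_affine_disjunct[of _ xs d] unfolding \<psi> by auto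
  show ?thesis
  proof (cases "?one \<in> set ts")
    case False
    then have in_ts: "min_indicator xs e \<in> set ts" "min_indicator xs e' \<in> set ts"
      using assms sat by auto
    \<comment> \<open>For empty \<open>xs\<close> the indicator is \<open>[]\<close>, which is also
      the all-ones vector.\<close>
    have "xs \<noteq> []" using False in_ts by (auto simp: min_indicator_def)
    then show ?thesis
      using min_indicator_mx_cases[of xs e e'] in_ts na[unfolded near_affine_iff[OF len]]
        min_indicator_neq_ones sat by (metis (no_types, lifting) UnE empty_iff insert_iff)
  qed (use sat in simp)
qed

section \<open>Temporal relations closed under \<open>mx\<close>\<close>

context
  fixes k R
  assumes tr: "temporal_relation k R" and pres: "preserves (mx \<alpha> \<beta>) R"
begin

lemma map2_mx_nth:
  assumes "x \<in> R" "y \<in> R"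
  shows "map2 (mx \<alpha> \<beta>) x y \<in> R" "i < k \<Longrightarrow> map2 (mx \<alpha> \<beta>) x y ! i = mx \<alpha> \<beta> (x ! i) (y ! i)"
proof -
  show "map2 (mx \<alpha> \<beta>) x y \<in> R" using assms pres unfolding preserves_def by blast
  show "map2 (mx \<alpha> \<beta>) x y ! i = mx \<alpha> \<beta> (x ! i) (y ! i)" if "i < k"
    using that assms temporal_relation_length[OF tr] by simp
qed

lemma near_affine_min_indicators:
  assumes "set xs \<subseteq> {..<k}"
  shows "near_affine (length xs) ((\<lambda>r. min_indicator xs ((!) r)) ` R)"
proof (subst near_affine_iff, force, intro ballI)
  fix s t
  assume "s \<in> (\<lambda>r. min_indicator xs ((!) r)) ` R" "t \<in> (\<lambda>r. min_indicator xs ((!) r)) ` R"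
  then obtain x y where x: "x \<in> R" "s = min_indicator xs ((!) x)"
    and y: "y \<in> R" "t = min_indicator xs ((!) y)" by blast
  let ?f = "\<lambda>x y. x + y + 1 :: bit"
  show "map2 ?f s t \<in> (\<lambda>r. min_indicator xs ((!) r)) ` R \<union> {replicate (length xs) 1}"
  proof (cases "xs = []")
    case True
    then show ?thesis using x by (simp add: min_indicator_def)
  next
    case False
    obtain i i' where i: "i \<in> argmin_set (set xs) ((!) x)" "i' \<in> argmin_set (set xs) ((!) y)"
      using False argmin_set_nonempty[of "set xs"] by blast
    have ik: "i < k" "i' < k" using i assms by (auto simp: argmin_set_def)
    \<comment> \<open>Translating \<open>y\<close> makes the two minima coincide, so that \<open>mx\<close> acts by \<open>?f\<close> on the indicators.\<close>
    define y' where "y' = map (\<lambda>q. q + (x ! i - y ! i')) y"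
    have y': "y' \<in> R" unfolding y'_def
      by (rule temporal_relation_map_strict_mono[OF tr y(1)]) (simp add: strict_mono_def)
    have nth: "y' ! j = y ! j + (x ! i - y ! i')" if "j < k" for j
      using that temporal_relation_length[OF tr y(1)] by (simp add: y'_def)
    have am: "argmin_set (set xs) ((!) y') = argmin_set (set xs) ((!) y)"
      using assms nth by (auto simp: argmin_set_def subset_iff)
    then have t: "t = min_indicator xs ((!) y')" using y min_indicator_eq_iff by simp
    define z where "z = map2 (mx \<alpha> \<beta>) x y'"
    have z: "z \<in> R" "argmin_set (set xs) ((!) z) = argmin_set (set xs) (\<lambda>j. mx \<alpha> \<beta> (x ! j) (y' ! j))"
      unfolding z_def using map2_mx_nth[OF x(1) y'] assms by (auto intro!: argmin_set_cong)
    have eq: "x ! i = y' ! i'" using nth[OF ik(2)] by simp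
    have "min_indicator xs ((!) z) = (if s = t then s else map2 ?f s t)"
      using min_indicator_mx_eq[OF i(1) i(2)[folded am] eq] z(2)[folded min_indicator_eq_iff]
      unfolding x(2) t by (rule trans[rotated])
    \<comment> \<open>When \<open>s = t\<close>, \<open>mx\<close> reproduces \<open>s\<close>
      instead of \<open>map2 ?f s t\<close>, but the latter is then all ones, the permitted
      exception.\<close>
    moreover have "map2 ?f s s = replicate (length xs) 1"
      using x(2) by (auto simp: list_eq_iff_nth_eq)
    ultimately show ?thesis using z(1) by (cases "s = t") (auto simp: image_iff, metis)
  qed
qed

lemma min_indicators_determine_order:
  assumes v: "\<And>V. V \<subseteq> {..<k} \<Longrightarrow> \<exists>r\<in>R. argmin_set V ((!) r) = argmin_set V ((!) v)"
    and "V \<subseteq> {..<k}"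
  shows "\<exists>r\<in>R. same_order_on V ((!) r) ((!) v)"
proof -
  have "finite V" using assms(2) finite_subset by blast
  then show ?thesis using assms(2)
  proof (induction V rule: finite_psubset_induct)
    case (psubset V)
    show ?case
    proof (cases "V = {}")
      case True
      \<comment> \<open>For empty \<open>V\<close>, the hypothesis \<open>v\<close> still yields
        that \<open>R\<close> is nonempty.\<close>
      then show ?thesis using v[of "{}"] by (auto simp: same_order_on_def)
    next
      case False
      define M where "M = argmin_set V ((!) v)"
      obtain i where i: "i \<in> M" using argmin_set_nonempty psubset.hyps False M_def by blast
      have M: "M \<subseteq> V" by (auto simp: M_def argmin_set_def)
      \<comment> \<open>Since \<open>i \<in> M\<close>, the set \<open>V - M\<close> is a proper
        subset of \<open>V\<close>.\<close>
      obtain r where r: "r \<in> R" "same_order_on (V - M) ((!) r) ((!) v)"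
        using psubset.IH[of "V - M"] psubset.prems i M by blast
      obtain s where s: "s \<in> R" "argmin_set V ((!) s) = M" using v psubset.prems M_def by blast
      have len: "length r = k" "length s = k" using r s temporal_relation_length[OF tr] by auto
      \<comment> \<open>Inserting \<open>0\<close> keeps \<open>Min\<close> and \<open>Max\<close>
        meaningful for an empty list and gives \<open>lo \<le> 0 \<le> hi\<close>.\<close>
      define lo hi where "lo = Min (insert 0 (set r))" and "hi = Max (insert 0 (set r))"
      have lohi: "lo \<le> r ! j" "r ! j \<le> hi" if "j < k" for j
        using that len by (auto simp: lo_def hi_def)
      have "lo \<le> 0" "0 \<le> hi" by (simp_all add: lo_def hi_def)
      then have "lo \<le> hi" by simp
      \<comment> \<open>Move \<open>s\<close> so that its minimum on \<open>V\<close> lies below all of \<open>r\<close> and its other entries on \<open>V\<close> above all of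
        \<open>r\<close>; then \<open>mx\<close> takes the minimum from \<open>s\<close> and the order on the remaining entries from \<open>r\<close>.\<close>
      define f where "f = (\<lambda>q. if q \<le> s ! i then q - s ! i + (lo - 1) else q - s ! i + hi)"
      have mono_f: "strict_mono f" using \<open>lo \<le> hi\<close> by (auto simp: f_def strict_mono_def)
      define z where "z = map2 (mx \<alpha> \<beta>) (map f s) r"
      have fs: "map f s \<in> R" by (rule temporal_relation_map_strict_mono[OF tr s(1) mono_f])
      have zR: "z \<in> R" unfolding z_def by (rule map2_mx_nth[OF fs r(1)])
      have z: "z ! j = mx \<alpha> \<beta> (f (s ! j)) (r ! j)" if "j < k" for j
        using map2_mx_nth(2)[OF fs r(1) that] that len by (simp add: z_def)
      have iS: "i \<in> V" "\<And>j. j \<in> V \<Longrightarrow> s ! i \<le> s ! j" using i s(2) by (auto simp: argmin_set_def)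
      have zM: "z ! j = \<alpha> (lo - 1)" if "j \<in> M" for j
      proof -
        have jk: "j < k" using that M psubset.prems by blast
        have "s ! j = s ! i" using that i unfolding s(2)[symmetric] argmin_set_def by (auto intro: antisym)
        then show ?thesis using z[OF jk] lohi(1)[OF jk] by (auto simp: f_def mx_def min_def)
      qed
      have zV: "z ! j = \<alpha> (r ! j)" "lo - 1 < r ! j" if "j \<in> V - M" for j
      proof -
        have jk: "j < k" using that psubset.prems by blast
        have "s ! i \<noteq> s ! j" using that iS unfolding s(2)[symmetric] argmin_set_def by auto
        then have "s ! i < s ! j" using iS that by (simp add: order_less_le)
        then show "z ! j = \<alpha> (r ! j)" "lo - 1 < r ! j"
          using z[OF jk] lohi[OF jk] by (auto simp: f_def mx_def min_def)
      qed
      have vM: "v ! j = v ! i" if "j \<in> M" for j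
        using that i unfolding M_def argmin_set_def by (auto intro: antisym)
      have vV: "v ! i < v ! j" if "j \<in> V - M" for j
        using that i unfolding M_def argmin_set_def by (auto simp: not_le intro: le_less_trans)
      \<comment> \<open>On \<open>V\<close>, \<open>z\<close> is \<open>\<alpha>\<close> applied to
        \<open>lo - 1\<close> on \<open>M\<close> and to \<open>r\<close> elsewhere, so strict
        monotonicity reduces the claim to these arguments.\<close>
      have "z ! a < z ! b \<longleftrightarrow> v ! a < v ! b" if "a \<in> V" "b \<in> V" for a b
      proof (cases "a \<in> M")
        case aM: True
        show ?thesis
          by (cases "b \<in> M") (use aM that zM zV vM vV mono_alpha in \<open>auto simp: strict_mono_less\<close>)
      next
        case aM: False
        show ?thesis
        proof (cases "b \<in> M")
          case True
          then have "z ! b < z ! a" "v ! b < v ! a"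
            using aM that zM zV vM vV mono_alpha by (auto simp: strict_mono_less)
          then show ?thesis by (meson less_asym)
        next
          case False
          then show ?thesis
            using aM that zV r(2) mono_alpha by (auto simp: strict_mono_less same_order_on_def)
        qed
      qed
      then show ?thesis using zR by (auto simp: same_order_on_def)
    qed
  qed
qed

text \<open>One formula is used per subset of coordinates, with the indicators occurring in
  \<open>R\<close> as its near-affine relation. The formula over the empty subset is false exactly
  when \<open>R\<close> is empty, which covers that case.\<close>

lemma min_affine_definition:
  "\<exists>\<psi>s. (\<forall>\<psi>\<in>set \<psi>s. \<exists>V\<subseteq>{..<k}. min_affine V \<psi>) \<and> fo_defines k (Conj \<psi>s) R"
proof -
  define T where "T xs = (\<lambda>r. min_indicator xs ((!) r)) ` R" for xs
  have "finite (T xs)" for xs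
  proof (rule finite_subset)
    show "T xs \<subseteq> {t. set t \<subseteq> {0, 1} \<and> length t = length xs}"
      by (auto simp: T_def min_indicator_def)
  qed (simp add: finite_lists_length_eq)
  then have "\<forall>xs. \<exists>l. set l = T xs" using finite_list by blast
  then obtain ts where ts: "set (ts xs) = T xs" for xs by metis
  define F where "F xs = Disj (map (min_affine_disjunct xs) (ts xs))" for xs
  \<comment> \<open>Every subset of \<open>{..<k}\<close> is represented here by a duplicate-free
    list.\<close>
  define Xs where "Xs = subseqs [0..<k]"
  have Xs: "distinct xs" "set xs \<subseteq> {..<k}" if "xs \<in> set Xs" for xs
  proof -
    have "set xs \<in> Pow (set [0..<k])" using that subseqs_powset by (metis Xs_def imageI)
    then show "set xs \<subseteq> {..<k}" by auto
    show "distinct xs" using that subseqs_distinctD[of xs "[0..<k]"] by (simp add: Xs_def)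
  qed
  have sat: "sat e (F xs) \<longleftrightarrow> min_indicator xs e \<in> T xs" for e xs
  proof -
    have "sat e (F xs) \<longleftrightarrow> replicate (length xs) 1 \<in> T xs \<or> min_indicator xs e \<in> T xs"
    proof -
      have "sat e (F xs) \<longleftrightarrow> (\<exists>t\<in>T xs. sat e (min_affine_disjunct xs t))" by (simp add: F_def ts)
      also have "\<dots> \<longleftrightarrow> (\<exists>t\<in>T xs. t = replicate (length xs) 1 \<or> t = min_indicator xs e)"
        by (intro bex_cong refl sat_min_affine_disjunct) (auto simp: T_def)
      finally show ?thesis by blast
    qed
    \<comment> \<open>An all-ones member of \<open>T xs\<close> forces \<open>xs = []\<close>, where
      every indicator is \<open>[]\<close>.\<close>
    moreover have "min_indicator xs e \<in> T xs" if "replicate (length xs) 1 \<in> T xs"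
    proof (cases "xs = []")
      case True
      then show ?thesis using that by (simp add: min_indicator_def)
    next
      case False
      then show ?thesis using that min_indicator_neq_ones unfolding T_def by fastforce
    qed
    ultimately show ?thesis by blast
  qed
  have "\<exists>V\<subseteq>{..<k}. min_affine V \<psi>" if \<psi>: "\<psi> \<in> set (map F Xs)" for \<psi>
  proof -
    obtain xs where xs: "xs \<in> set Xs" "\<psi> = F xs" using \<psi> by auto
    have "near_affine (length xs) (set (ts xs))"
      unfolding ts T_def by (rule near_affine_min_indicators[OF Xs(2)[OF xs(1)]])
    then have "min_affine (set xs) \<psi>" unfolding min_affine_def xs(2) F_def using Xs(1)[OF xs(1)] by blast
    then show ?thesis using Xs(2)[OF xs(1)] by blast
  qed
  moreover have "fo_defines k (Conj (map F Xs)) R"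
    unfolding fo_defines_def
  proof (intro conjI set_eqI iffI)
    show "fv (Conj (map F Xs)) \<subseteq> {..<k}"
    proof -
      have "fv (F xs) \<subseteq> set xs" for xs using fv_min_affine_disjunct[of xs] by (auto simp: F_def)
      then show ?thesis using Xs(2) by fastforce
    qed
    fix v
    show "v \<in> {v. length v = k \<and> sat ((!) v) (Conj (map F Xs))}" if "v \<in> R"
      using that temporal_relation_length[OF tr] sat by (auto simp: T_def)
    assume "v \<in> {v. length v = k \<and> sat ((!) v) (Conj (map F Xs))}"
    then have len: "length v = k" and sats: "\<forall>xs\<in>set Xs. sat ((!) v) (F xs)" by simp_all
    then have v: "min_indicator xs ((!) v) \<in> T xs" if "xs \<in> set Xs" for xs
      using that sat by blast
    have "\<exists>r\<in>R. argmin_set V ((!) r) = argmin_set V ((!) v)" if "V \<subseteq> {..<k}" for V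
    proof -
      have "V \<in> set ` set Xs" using that subseqs_powset[of "[0..<k]"] by (auto simp: Xs_def)
      then obtain xs where xs: "xs \<in> set Xs" "V = set xs" by blast
      obtain r where "r \<in> R" "min_indicator xs ((!) v) = min_indicator xs ((!) r)"
        using v[OF xs(1)] unfolding T_def by blast
      then show ?thesis unfolding xs(2) min_indicator_eq_iff by metis
    qed
    then obtain r where "r \<in> R" "same_order_on {..<k} ((!) r) ((!) v)"
      using min_indicators_determine_order[of v "{..<k}"] by blast
    then show "v \<in> R" using temporal_relation_same_order[OF tr] len by blast
  qed
  ultimately show ?thesis by blast
qed

end

end

theorem theorem3p4:
  fixes \<alpha> \<beta> :: "rat \<Rightarrow> rat" and k :: nat and R :: "rat list set"
  assumes "strict_mono \<alpha>" and "strict_mono \<beta>"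
    and "\<And>x \<epsilon> :: rat. \<epsilon> > 0 \<Longrightarrow> \<alpha> x < \<beta> x \<and> \<beta> x < \<alpha> (x + \<epsilon>)"
    and "temporal_relation k R"
  shows "preserves (mx \<alpha> \<beta>) R \<longleftrightarrow>
    (\<exists>\<psi>s. (\<forall>\<psi>\<in>set \<psi>s. \<exists>V\<subseteq>{..<k}. min_affine V \<psi>) \<and> fo_defines k (Conj \<psi>s) R)"
proof -
  interpret mx_ops \<alpha> \<beta>
  proof
    show "strict_mono \<alpha>" by fact
    show "\<alpha> x < \<beta> x" for x using assms(3)[of 1 x] by simp
    show "\<beta> x < \<alpha> y" if "x < y" for x y using assms(3)[of "y - x" x] that by simp
  qed
  show ?thesis
  proof
    assume "preserves (mx \<alpha> \<beta>) R"
    then show "\<exists>\<psi>s. (\<forall>\<psi>\<in>set \<psi>s. \<exists>V\<subseteq>{..<k}. min_affine V \<psi>) \<and> fo_defines k (Conj \<psi>s) R"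
      by (rule min_affine_definition[OF assms(4)])
  next
    assume "\<exists>\<psi>s. (\<forall>\<psi>\<in>set \<psi>s. \<exists>V\<subseteq>{..<k}. min_affine V \<psi>) \<and> fo_defines k (Conj \<psi>s) R"
    then obtain \<psi>s where ma: "\<And>\<psi>. \<psi> \<in> set \<psi>s \<Longrightarrow> \<exists>V\<subseteq>{..<k}. min_affine V \<psi>"
      and fv: "fv (Conj \<psi>s) \<subseteq> {..<k}"
      and R: "R = {v. length v = k \<and> sat ((!) v) (Conj \<psi>s)}"
      unfolding fo_defines_def by blast
    show "preserves (mx \<alpha> \<beta>) R" unfolding preserves_def
    proof (intro ballI)
      fix x y assume xy: "x \<in> R" "y \<in> R"
      let ?z = "map2 (mx \<alpha> \<beta>) x y"
      have len: "length x = k" "length y = k" using xy R by auto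
      have "sat (\<lambda>j. mx \<alpha> \<beta> (x ! j) (y ! j)) (Conj \<psi>s)"
        using xy R ma sat_min_affine_mx by fastforce
      \<comment> \<open>The two assignments are known to agree only on indices below
        \<open>k\<close>, the range of the free variables.\<close>
      moreover have "same_order_on (fv (Conj \<psi>s)) (\<lambda>j. mx \<alpha> \<beta> (x ! j) (y ! j)) ((!) ?z)"
        by (rule same_order_on_subset[OF _ fv]) (use len in \<open>auto simp: same_order_on_def\<close>)
      ultimately have "sat ((!) ?z) (Conj \<psi>s)" using sat_same_order by blast
      then show "?z \<in> R" using R len by simp
    qed
  qed
qed

end
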